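(* Let $\gamma_k=\frac{p+1}{k+p+1}$ for all $k\ge 0$. Then for all iterates $\{x_k\}_{k\ge1}$ generated by the Contracting-Point Tensor Method I (described in the context) with constant $c\ge 0$, we have $$F(x_k)-F^*\;\le\;(p+1)^{p+1}\cdot\bigl(c+2\Delta^{(p)}_{\mathrm{dom}\,\psi}(f)\bigr)\cdot k^{-p},\qquad k\ge 1.$$
   Context: Setting. $\mathbb{E}$ is a finite-dimensional real vector space. The problem is $F^*=\min_{x\in\mathrm{dom}\,\psi}[F(x)=f(x)+\psi(x)]$, where $\psi:\mathbb{E}\to\mathbb{R}\cup\{+\infty\}$ is a proper closed convex function with bounded domain $\mathrm{dom}\,\psi=\{x:\psi(x)<+\infty\}$, and $f$ is convex and $p\ge 1$ times continuously differentiable at every point of $\mathrm{dom}\,\psi$. $D^if(x)[h]^i$ is the $i$th directional derivative of $f$ at $x$ along $h$ (repeated $i$ times). For $x_k\in\mathrm{dom}\,\psi$, $\gamma_k\in(0,1]$ and $y=(1-\gamma_k)x_k+\gamma_kv$ with $v\in\mathrm{dom}\,\psi$, put $S_k(y)=\gamma_k\psi\bigl(x_k+\frac1{\gamma_k}(y-x_k)\bigr)=\gamma_k\psi(v)$ and $M_k(y)=\Omega_p(f,x_k;y)+S_k(y)$, where $\Omega_p(f,x_k;y)=f(x_k)+\sum_{i=1}^p\frac1{i!}D^if(x_k)[y-x_k]^i$. $M_k^*$ denotes the global minimum of $M_k(y)$ over all $y=(1-\gamma_k)x_k+\gamma_kv$, $v\in\mathrm{dom}\,\psi$. Contracting-Point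 Tensor Method I. Choose $x_0\in\mathrm{dom}\,\psi$ and $c\ge 0$. At iteration $k\ge 0$: (1) choose $\gamma_k\in(0,1]$; (2) for some $0\le\xi_{k+1}\le c\gamma_k^{p+1}$ find $\bar x_{k+1}=(1-\gamma_k)x_k+\gamma_k\bar v_{k+1}$ with $\bar v_{k+1}\in\mathrm{dom}\,\psi$ such that $M_k(\bar x_{k+1})-M_k^*\le\xi_{k+1}$; (3) if $F(\bar x_{k+1})\le F(x_k)$ set $x_{k+1}=\bar x_{k+1}$, else set $x_{k+1}=x_k$. For a convex set $Q$, $$\Delta^{(p)}_Q(f)=\sup_{x,v\in Q,\;t\in(0,1]}\frac1{t^{p+1}}\Bigl|f(x+t(v-x))-f(x)-\sum_{i=1}^p\frac{t^i}{i!}D^if(x)[v-x]^i\Bigr|\in[0,+\infty]$$ (the asserted bound is void if this quantity is $+\infty$). *)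

theory Defs
  imports "HOL-Analysis.Analysis"
begin

definition eff_dom :: "('a \<Rightarrow> ereal) \<Rightarrow> 'a set" where
  "eff_dom \<psi> = {x. \<psi> x < \<infinity>}"

definition ereal_epigraph :: "('a \<Rightarrow> ereal) \<Rightarrow> ('a \<times> real) set" where
  "ereal_epigraph \<psi> = {(x, r). \<psi> x \<le> ereal r}"

definition proper_closed_convex :: "('a::real_normed_vector \<Rightarrow> ereal) \<Rightarrow> bool" where
  "proper_closed_convex \<psi> \<longleftrightarrow>
     (\<forall>x. \<psi> x \<noteq> -\<infinity>) \<and> eff_dom \<psi> \<noteq> {} \<and>
     closed (ereal_epigraph \<psi>) \<and> convex (ereal_epigraph \<psi>)"

(* All Frechet derivatives of order at most p exist near x, and the p-th one is
   continuous at x; the derivative of order i is handled through its values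
   D^i f(y)[v_1, ..., v_i] for arbitrary fixed directions v_1, ..., v_i. *)
primrec cont_differentiable_at :: "nat \<Rightarrow> ('a::real_normed_vector \<Rightarrow> real) \<Rightarrow> 'a \<Rightarrow> bool" where
  "cont_differentiable_at 0 f x \<longleftrightarrow> continuous (at x) f"
| "cont_differentiable_at (Suc p) f x \<longleftrightarrow>
     (\<forall>\<^sub>F y in nhds x. f differentiable (at y)) \<and>
     (\<forall>v. cont_differentiable_at p (\<lambda>y. frechet_derivative f (at y) v) x)"

(* D^i f(x)[h]^i *)
definition dir_deriv :: "nat \<Rightarrow> ('a::real_vector \<Rightarrow> real) \<Rightarrow> 'a \<Rightarrow> 'a \<Rightarrow> real" where
  "dir_deriv i f x h = (deriv ^^ i) (\<lambda>t. f (x + t *\<^sub>R h)) 0"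

definition taylor_model :: "nat \<Rightarrow> ('a::real_vector \<Rightarrow> real) \<Rightarrow> 'a \<Rightarrow> 'a \<Rightarrow> real" where
  "taylor_model p f x y = f x + (\<Sum>i=1..p. 1 / fact i * dir_deriv i f x (y - x))"

(* Delta_Q^(p)(f); for nonempty Q its value lies in [0, \<infinity>]. *)
definition taylor_defect :: "nat \<Rightarrow> 'a::real_vector set \<Rightarrow> ('a \<Rightarrow> real) \<Rightarrow> ereal" where
  "taylor_defect p Q f =
     (SUP x\<in>Q. SUP v\<in>Q. SUP t\<in>{0<..1::real}.
        ereal (1 / t ^ (p + 1) *
          \<bar>f (x + t *\<^sub>R (v - x)) - f x - (\<Sum>i=1..p. t ^ i / fact i * dir_deriv i f x (v - x))\<bar>))"

definition objective :: "('a \<Rightarrow> real) \<Rightarrow> ('a \<Rightarrow> ereal) \<Rightarrow> 'a \<Rightarrow> ereal" where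
  "objective f \<psi> x = ereal (f x) + \<psi> x"

(* Under the standing assumptions the infimum is attained; likewise in model_min. *)
definition opt_value :: "('a \<Rightarrow> real) \<Rightarrow> ('a \<Rightarrow> ereal) \<Rightarrow> ereal" where
  "opt_value f \<psi> = (INF x\<in>eff_dom \<psi>. objective f \<psi> x)"

definition model :: "nat \<Rightarrow> ('a::real_vector \<Rightarrow> real) \<Rightarrow> ('a \<Rightarrow> ereal) \<Rightarrow> real \<Rightarrow> 'a \<Rightarrow> 'a \<Rightarrow> ereal" where
  "model p f \<psi> \<gamma> x y =
     ereal (taylor_model p f x y) + ereal \<gamma> * \<psi> (x + (1 / \<gamma>) *\<^sub>R (y - x))"

definition model_min :: "nat \<Rightarrow> ('a::real_vector \<Rightarrow> real) \<Rightarrow> ('a \<Rightarrow> ereal) \<Rightarrow> real \<Rightarrow> 'a \<Rightarrow> ereal" where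
  "model_min p f \<psi> \<gamma> x =
     (INF y\<in>{(1 - \<gamma>) *\<^sub>R x + \<gamma> *\<^sub>R v | v. v \<in> eff_dom \<psi>}. model p f \<psi> \<gamma> x y)"

definition contracting_point_tensor_seq ::
  "nat \<Rightarrow> real \<Rightarrow> ('a::real_vector \<Rightarrow> real) \<Rightarrow> ('a \<Rightarrow> ereal) \<Rightarrow> (nat \<Rightarrow> real) \<Rightarrow> (nat \<Rightarrow> 'a) \<Rightarrow> bool" where
  "contracting_point_tensor_seq p c f \<psi> \<gamma> x \<longleftrightarrow>
     x 0 \<in> eff_dom \<psi> \<and>
     (\<forall>k. 0 < \<gamma> k \<and> \<gamma> k \<le> 1 \<and>
        (\<exists>\<xi> v' x'. 0 \<le> \<xi> \<and> \<xi> \<le> c * \<gamma> k ^ (p + 1) \<and>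
           v' \<in> eff_dom \<psi> \<and> x' = (1 - \<gamma> k) *\<^sub>R x k + \<gamma> k *\<^sub>R v' \<and>
           model p f \<psi> (\<gamma> k) (x k) x' - model_min p f \<psi> (\<gamma> k) (x k) \<le> ereal \<xi> \<and>
           x (Suc k) = (if objective f \<psi> x' \<le> objective f \<psi> (x k) then x' else x k)))"

end

theory Submission
  imports Defs
begin

text \<open>
  One iteration is compared with an arbitrary point \<open>v\<close> of the domain.  Convexity of \<open>\<psi>\<close>,
  two applications of the Taylor bound (at the new point and at the contraction of \<open>v\<close>) and
  approximate minimality of the model give
  \<open>F x\<^bsub>k+1\<^esub> - F v \<le> (1 - \<gamma>\<^sub>k) (F x\<^sub>k - F v) + (c + 2 \<Delta>) \<gamma>\<^sub>k\<^bsup>p+1\<^esup>\<close>.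
  With \<open>A\<^sub>k = k (k + 1) \<dots> (k + p)\<close> one has \<open>1 - \<gamma>\<^sub>k = A\<^sub>k / A\<^bsub>k+1\<^esub>\<close> and
  \<open>A\<^bsub>k+1\<^esub> \<gamma>\<^sub>k\<^bsup>p+1\<^esup> \<le> (p + 1)\<^bsup>p+1\<^esup>\<close>, so the recursion telescopes after
  multiplication by \<open>A\<^bsub>k+1\<^esub>\<close>, and \<open>A\<^sub>k \<ge> k\<^bsup>p+1\<^esup>\<close> gives the rate.
\<close>

section \<open>Homogeneity of directional derivatives and the Taylor bound\<close>

text \<open>Links iterated derivatives along a line with the recursion of
  \<open>cont_differentiable_at\<close>, which takes one Frechet derivative in a fixed direction.
  The chain rule yields a factor \<open>a\<close> each time; \<open>b\<close> collects these factors
  while \<open>h\<close> stays fixed.\<close>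

lemma dir_deriv_Suc_scaled:
  fixes f :: "'a::real_normed_vector \<Rightarrow> real"
  assumes "cont_differentiable_at (Suc p) f x"
  shows "dir_deriv (Suc i) (\<lambda>y. b * f y) x (a *\<^sub>R h) =
         dir_deriv i (\<lambda>y. (b * a) * frechet_derivative f (at y) h) x (a *\<^sub>R h)"
proof -
  define g where "g t = x + t *\<^sub>R (a *\<^sub>R h)" for t :: real
  have ev: "\<forall>\<^sub>F y in nhds x. f differentiable (at y)"
    using assms by simp
  have "filterlim g (nhds x) (nhds 0)"
  proof -
    have "isCont g 0"
      unfolding g_def by (intro continuous_intros)
    moreover have "g 0 = x"
      by (simp add: g_def)
    ultimately show ?thesis
      using tendsto_at_iff_tendsto_nhds[of g 0] by (simp add: isCont_def)
  qed
  then have "\<forall>\<^sub>F t in nhds 0. f differentiable (at (g t))"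
    using ev by (rule eventually_compose_filterlim[rotated])
  then have "\<forall>\<^sub>F t in nhds 0.
      deriv (\<lambda>t. b * f (g t)) t = (b * a) * frechet_derivative f (at (g t)) h"
  proof (rule eventually_mono)
    fix t assume d: "f differentiable (at (g t))"
    let ?L = "frechet_derivative f (at (g t))"
    have L: "(f has_derivative ?L) (at (g t))"
      using d by (simp add: frechet_derivative_works)
    have "(g has_derivative (\<lambda>s. s *\<^sub>R (a *\<^sub>R h))) (at t)"
      unfolding g_def by (auto intro!: derivative_eq_intros)
    then have "((\<lambda>t. f (g t)) has_derivative (\<lambda>s. ?L (s *\<^sub>R (a *\<^sub>R h)))) (at t)"
      using L by (rule has_derivative_compose)
    then have "((\<lambda>t. b * f (g t)) has_derivative (\<lambda>s. b * ?L (s *\<^sub>R (a *\<^sub>R h)))) (at t)"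
      by (rule has_derivative_mult_right)
    moreover have "(\<lambda>s. b * ?L (s *\<^sub>R (a *\<^sub>R h))) = (*) ((b * a) * ?L h)"
      using has_derivative_linear[OF L] by (auto simp: linear_cmul)
    ultimately have "((\<lambda>t. b * f (g t)) has_field_derivative (b * a) * ?L h) (at t)"
      by (simp add: has_field_derivative_def)
    then show "deriv (\<lambda>t. b * f (g t)) t = (b * a) * ?L h"
      by (rule DERIV_imp_deriv)
  qed
  \<comment> \<open>Iterated derivatives at \<open>0\<close> depend only on values near
    \<open>0\<close>, so equality on a neighbourhood suffices.\<close>
  then have "(deriv ^^ i) (deriv (\<lambda>t. b * f (g t))) 0 =
             (deriv ^^ i) (\<lambda>t. (b * a) * frechet_derivative f (at (g t)) h) 0"
    by (rule higher_deriv_cong_ev) simp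
  then show ?thesis
    by (simp add: dir_deriv_def g_def funpow_swap1)
qed

text \<open>The induction generalizes \<open>p\<close>, \<open>f\<close> and \<open>b\<close>: each
  step lowers \<open>p\<close>, replaces \<open>f\<close> by its derivative along \<open>h\<close>
  and multiplies \<open>b\<close> by \<open>a\<close>.\<close>

lemma dir_deriv_scaled:
  fixes f :: "'a::real_normed_vector \<Rightarrow> real"
  assumes "cont_differentiable_at p f x" "i \<le> p"
  shows "dir_deriv i (\<lambda>y. b * f y) x (a *\<^sub>R h) = b * a ^ i * dir_deriv i f x h"
  using assms
proof (induction i arbitrary: p f b)
  case 0
  then show ?case by (simp add: dir_deriv_def)
next
  case (Suc i)
  then obtain q where p: "p = Suc q" and q: "i \<le> q"
    by (cases p) auto
  let ?g = "\<lambda>y. frechet_derivative f (at y) h"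
  have f: "cont_differentiable_at (Suc q) f x" and g: "cont_differentiable_at q ?g x"
    using Suc.prems p by auto
  have "dir_deriv (Suc i) (\<lambda>y. 1 * f y) x (1 *\<^sub>R h) = dir_deriv i (\<lambda>y. (1 * 1) * ?g y) x (1 *\<^sub>R h)"
    by (rule dir_deriv_Suc_scaled[OF f])
  then have "dir_deriv (Suc i) f x h = dir_deriv i ?g x h"
    by simp
  moreover have "dir_deriv (Suc i) (\<lambda>y. b * f y) x (a *\<^sub>R h) = (b * a) * a ^ i * dir_deriv i ?g x h"
    unfolding dir_deriv_Suc_scaled[OF f] by (rule Suc.IH[OF g q])
  ultimately show ?case by simp
qed

text \<open>The model differentiates along \<open>y - x\<close>, the Taylor defect along
  \<open>v - x\<close> with explicit powers of \<open>t\<close>; homogeneity reconciles the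
  two.\<close>

lemma taylor_model_contraction:
  fixes f :: "'a::real_normed_vector \<Rightarrow> real"
  assumes "cont_differentiable_at p f x"
  shows "taylor_model p f x (x + t *\<^sub>R h) = f x + (\<Sum>i=1..p. t ^ i / fact i * dir_deriv i f x h)"
proof -
  have "dir_deriv i f x (t *\<^sub>R h) = t ^ i * dir_deriv i f x h" if "i \<le> p" for i
    using dir_deriv_scaled[OF assms that, of 1 t h] by simp
  then show ?thesis
    unfolding taylor_model_def by (simp cong: sum.cong_simp)
qed

lemma taylor_defect_bound:
  fixes f :: "'a::real_normed_vector \<Rightarrow> real"
  assumes diff: "cont_differentiable_at p f x" and "x \<in> Q" "v \<in> Q" "0 < t" "t \<le> 1"
    and D: "taylor_defect p Q f = ereal D"
  shows "\<bar>f (x + t *\<^sub>R (v - x)) - taylor_model p f x (x + t *\<^sub>R (v - x))\<bar> \<le> D * t ^ (p + 1)"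
proof -
  have "ereal (1 / t ^ (p + 1) *
      \<bar>f (x + t *\<^sub>R (v - x)) - f x - (\<Sum>i=1..p. t ^ i / fact i * dir_deriv i f x (v - x))\<bar>)
      \<le> taylor_defect p Q f"
    unfolding taylor_defect_def
    using assms(2-5) by (intro SUP_upper2[of x] SUP_upper2[of v] SUP_upper2[of t]) auto
  then show ?thesis
    unfolding taylor_model_contraction[OF diff] using D \<open>0 < t\<close> by (simp add: field_simps)
qed

lemma taylor_defect_nonneg:
  assumes "Q \<noteq> {}"
  shows "0 \<le> taylor_defect p Q f"
proof -
  obtain x where "x \<in> Q" using assms by auto
  then show ?thesis
    unfolding taylor_defect_def
    by (intro SUP_upper2[of x] SUP_upper2[of x] SUP_upper2[of "1::real"]) auto
qed

section \<open>Real values and convexity of the extended-valued term\<close>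

lemma proper_eff_dom_real:
  assumes "proper_closed_convex \<psi>" "x \<in> eff_dom \<psi>"
  shows "ereal (real_of_ereal (\<psi> x)) = \<psi> x"
  using assms by (cases "\<psi> x") (auto simp: proper_closed_convex_def eff_dom_def)

text \<open>Convexity of the epigraph is applied to the graph points above \<open>x\<close> and
  \<open>v\<close>, whose heights are finite.\<close>

lemma proper_convex_combination:
  assumes \<psi>: "proper_closed_convex \<psi>" and x: "x \<in> eff_dom \<psi>" and v: "v \<in> eff_dom \<psi>"
    and "0 \<le> t" "t \<le> 1"
  shows "(1 - t) *\<^sub>R x + t *\<^sub>R v \<in> eff_dom \<psi>"
    and "real_of_ereal (\<psi> ((1 - t) *\<^sub>R x + t *\<^sub>R v))
         \<le> (1 - t) * real_of_ereal (\<psi> x) + t * real_of_ereal (\<psi> v)"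
proof -
  let ?y = "(1 - t) *\<^sub>R x + t *\<^sub>R v"
  let ?r = "(1 - t) * real_of_ereal (\<psi> x) + t * real_of_ereal (\<psi> v)"
  have "(x, real_of_ereal (\<psi> x)) \<in> ereal_epigraph \<psi>" "(v, real_of_ereal (\<psi> v)) \<in> ereal_epigraph \<psi>"
    using proper_eff_dom_real[OF \<psi>] x v by (auto simp: ereal_epigraph_def)
  moreover have "convex (ereal_epigraph \<psi>)"
    using \<psi> by (simp add: proper_closed_convex_def)
  ultimately have "(1 - t) *\<^sub>R (x, real_of_ereal (\<psi> x)) + t *\<^sub>R (v, real_of_ereal (\<psi> v)) \<in> ereal_epigraph \<psi>"
    using assms(4,5) by (intro convexD) auto
  then have le: "\<psi> ?y \<le> ereal ?r"
    by (simp add: ereal_epigraph_def)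
  then show dom: "?y \<in> eff_dom \<psi>"
    by (auto simp: eff_dom_def intro: le_less_trans)
  show "real_of_ereal (\<psi> ?y) \<le> ?r"
    using le proper_eff_dom_real[OF \<psi> dom] by (metis ereal_less_eq(3))
qed

section \<open>One iteration of the method\<close>

text \<open>The rescaling inside \<open>model\<close> undoes the contraction and recovers
  \<open>v\<close>, so only the finite value of \<psi> at \<open>v\<close> enters.\<close>

lemma model_contraction:
  assumes "\<gamma> \<noteq> 0" "proper_closed_convex \<psi>" "v \<in> eff_dom \<psi>"
  shows "model p f \<psi> \<gamma> x (x + \<gamma> *\<^sub>R (v - x)) =
         ereal (taylor_model p f x (x + \<gamma> *\<^sub>R (v - x)) + \<gamma> * real_of_ereal (\<psi> v))"
  using assms(1) proper_eff_dom_real[OF assms(2,3)]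
  by (cases "\<psi> v") (auto simp: model_def)

lemma model_min_le:
  assumes "v \<in> eff_dom \<psi>"
  shows "model_min p f \<psi> \<gamma> x \<le> model p f \<psi> \<gamma> x (x + \<gamma> *\<^sub>R (v - x))"
  unfolding model_min_def
  by (rule INF_lower) (use assms in \<open>auto simp: algebra_simps intro!: exI[of _ v]\<close>)

lemma contracting_point_step:
  fixes f :: "'a::real_normed_vector \<Rightarrow> real"
  assumes \<psi>: "proper_closed_convex \<psi>" and f: "convex_on (eff_dom \<psi>) f"
    and diff: "cont_differentiable_at p f x"
    and D: "taylor_defect p (eff_dom \<psi>) f = ereal D"
    and \<gamma>: "0 < \<gamma>" "\<gamma> \<le> 1"
    and x: "x \<in> eff_dom \<psi>" and w: "w \<in> eff_dom \<psi>" and v: "v \<in> eff_dom \<psi>"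
    and min: "model p f \<psi> \<gamma> x ((1 - \<gamma>) *\<^sub>R x + \<gamma> *\<^sub>R w) - model_min p f \<psi> \<gamma> x \<le> ereal \<xi>"
  defines "y \<equiv> (1 - \<gamma>) *\<^sub>R x + \<gamma> *\<^sub>R w"
    and "F \<equiv> \<lambda>z. f z + real_of_ereal (\<psi> z)"
  shows "F y - F v \<le> (1 - \<gamma>) * (F x - F v) + \<xi> + 2 * D * \<gamma> ^ (p + 1)"
proof -
  have y: "y = x + \<gamma> *\<^sub>R (w - x)" by (simp add: y_def algebra_simps)
  define z where "z = x + \<gamma> *\<^sub>R (v - x)"
  have z: "z = (1 - \<gamma>) *\<^sub>R x + \<gamma> *\<^sub>R v" by (simp add: z_def algebra_simps)
  \<comment> \<open>The value \<open>-\<infinity>\<close> of \<open>model_min\<close> contradicts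
    \<open>min\<close>, since subtracting it gives \<open>\<infinity>\<close>; for
    \<open>\<infinity>\<close> the bound is trivial.\<close>
  have "model p f \<psi> \<gamma> x y \<le> model_min p f \<psi> \<gamma> x + ereal \<xi>"
    using min unfolding y_def
    by (cases "model_min p f \<psi> \<gamma> x") (auto simp: ereal_minus_le_iff add.commute)
  also have "\<dots> \<le> model p f \<psi> \<gamma> x z + ereal \<xi>"
    unfolding z_def by (intro add_right_mono model_min_le v)
  finally have "taylor_model p f x y + \<gamma> * real_of_ereal (\<psi> w)
      \<le> taylor_model p f x z + \<gamma> * real_of_ereal (\<psi> v) + \<xi>"
    using model_contraction[OF _ \<psi> w, of \<gamma> p f x] model_contraction[OF _ \<psi> v, of \<gamma> p f x] \<gamma>
    by (simp add: y z_def)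
  moreover have "\<bar>f y - taylor_model p f x y\<bar> \<le> D * \<gamma> ^ (p + 1)"
    unfolding y by (rule taylor_defect_bound[OF diff x w \<gamma> D])
  moreover have "\<bar>f z - taylor_model p f x z\<bar> \<le> D * \<gamma> ^ (p + 1)"
    unfolding z_def by (rule taylor_defect_bound[OF diff x v \<gamma> D])
  \<comment> \<open>Convexity of \<psi> enters at the new point \<open>y\<close>, where the model
    contains only the contribution of \<open>w\<close>; convexity of \<open>f\<close> enters at the
    comparison point \<open>z\<close>.\<close>
  moreover have "real_of_ereal (\<psi> y) \<le> (1 - \<gamma>) * real_of_ereal (\<psi> x) + \<gamma> * real_of_ereal (\<psi> w)"
    unfolding y_def using proper_convex_combination(2)[OF \<psi> x w] \<gamma> by simp
  moreover have "f z \<le> (1 - \<gamma>) * f x + \<gamma> * f v"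
    unfolding z using convex_onD[OF f, of \<gamma> x v] \<gamma> x v by simp
  ultimately show ?thesis
    unfolding F_def by (simp add: algebra_simps)
qed

section \<open>Rising factorials and the scalar recursion\<close>

lemma pochhammer_ge_power:
  fixes a :: "'a::linordered_semidom"
  assumes "0 \<le> a"
  shows "a ^ n \<le> pochhammer a n"
proof (induction n)
  case (Suc n)
  moreover have "0 \<le> pochhammer a n"
    using zero_le_power[OF assms] Suc by (rule order_trans)
  ultimately have "a ^ n * a \<le> pochhammer a n * (a + of_nat n)"
    using assms by (intro mult_mono) auto
  then show ?case by (simp add: pochhammer_Suc mult.commute)
qed simp

text \<open>The factors run from \<open>a + 1\<close> to \<open>a + n\<close>. For
  \<open>a = k\<close> and \<open>n = p + 1\<close> the largest one is exactly the denominator of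
  the step size.\<close>

lemma pochhammer_le_power:
  fixes a :: "'a::linordered_semidom"
  assumes "0 \<le> a"
  shows "pochhammer (a + 1) n \<le> (a + of_nat n) ^ n"
proof -
  have "pochhammer (a + 1) n = (\<Prod>i<n. a + 1 + of_nat i)"
    by (simp add: pochhammer_prod lessThan_atLeast0)
  also have "\<dots> \<le> (\<Prod>i<n. a + of_nat n)"
  proof (intro prod_mono conjI)
    fix i assume "i \<in> {..<n}"
    then have "of_nat (Suc i) \<le> (of_nat n :: 'a)"
      by (intro of_nat_mono) auto
    then show "a + 1 + of_nat i \<le> a + of_nat n"
      by (simp add: add.assoc)
  qed (use assms in auto)
  finally show ?thesis by simp
qed

lemma contracting_recursion_rate:
  fixes \<delta> :: "nat \<Rightarrow> real" and p :: nat
  assumes C: "0 \<le> C"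
    and rec: "\<And>k. \<delta> (Suc k) \<le> (1 - g k) * \<delta> k + C * g k ^ (p + 1)"
    and g: "\<And>k. g k = (real p + 1) / (real k + real p + 1)"
    and k: "1 \<le> k"
  shows "\<delta> k \<le> (real p + 1) ^ (p + 1) * C / real k ^ p"
proof -
  let ?A = "\<lambda>k. pochhammer (real k) (p + 1)"
  let ?K = "(real p + 1) ^ (p + 1)"
  \<comment> \<open>The weight \<open>?A 0\<close> vanishes, so the initial gap
    \<open>\<delta> 0\<close> drops out, and every step adds at most \<open>?K * C\<close>.\<close>
  have tele: "?A n * \<delta> n \<le> real n * (?K * C)" for n
  proof (induction n)
    case 0
    then show ?case by (simp add: pochhammer_rec)
  next
    case (Suc n)
    have pos: "0 < real n + real p + 1" by simp
    have A: "?A (Suc n) * (1 - g n) = ?A n"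
    proof -
      \<comment> \<open>Both sides equal \<open>n (n + 1) ... (n + p + 1)\<close>, with either the
        first or the last factor split off.\<close>
      have "?A (Suc n) * real n = ?A n * (real n + real p + 1)"
        using pochhammer_rec[of "real n" "p + 1"] pochhammer_Suc[of "real n" "p + 1"]
        by (simp add: algebra_simps)
      moreover have "1 - g n = real n / (real n + real p + 1)"
        using pos by (simp add: g field_simps)
      ultimately have "?A (Suc n) * (1 - g n)
          = ?A n * (real n + real p + 1) / (real n + real p + 1)"
        by (simp only: times_divide_eq_right)
      then show ?thesis using pos by simp
    qed
    have G: "?A (Suc n) * g n ^ (p + 1) \<le> ?K"
    proof -
      have "?A (Suc n) \<le> (real n + real p + 1) ^ (p + 1)"
        using pochhammer_le_power[of "real n" "p + 1"] by (simp add: algebra_simps)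
      then show ?thesis
        using pos by (simp add: g power_divide divide_le_eq mult.commute mult_left_mono del: power_Suc)
    qed
    have "?A (Suc n) * \<delta> (Suc n) \<le> ?A (Suc n) * ((1 - g n) * \<delta> n + C * g n ^ (p + 1))"
      by (intro mult_left_mono rec pochhammer_nonneg) auto
    also have "\<dots> = ?A n * \<delta> n + C * (?A (Suc n) * g n ^ (p + 1))"
      unfolding A[symmetric] by (simp add: algebra_simps)
    also have "\<dots> \<le> real n * (?K * C) + C * ?K"
      by (intro add_mono Suc.IH mult_left_mono G C)
    finally show ?case by (simp add: algebra_simps)
  qed
  have "real k ^ (p + 1) * \<delta> k \<le> real k * (?K * C)"
  \<comment> \<open>Replacing the weight by the smaller \<open>k ^ (p + 1)\<close> preserves the
    bound only for nonnegative \<open>\<delta> k\<close>. A negative gap can occur, because the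
    comparison point is arbitrary.\<close>
  proof (cases "0 \<le> \<delta> k")
    case True
    then have "real k ^ (p + 1) * \<delta> k \<le> ?A k * \<delta> k"
      by (intro mult_right_mono pochhammer_ge_power) auto
    then show ?thesis using tele[of k] by linarith
  next
    case False
    then have "real k ^ (p + 1) * \<delta> k \<le> 0"
      by (intro mult_nonneg_nonpos) auto
    also have "0 \<le> real k * (?K * C)" using C by simp
    finally show ?thesis .
  qed
  then have "real k * (real k ^ p * \<delta> k) \<le> real k * (?K * C)"
    by (simp add: mult.assoc)
  then have "real k ^ p * \<delta> k \<le> ?K * C"
    using k by simp
  then show ?thesis using k by (simp add: pos_le_divide_eq mult.commute)
qed

section \<open>The rate for the method, from the step inequality and the recursion\<close>

theorem theorem4:
  fixes f :: "'a::euclidean_space \<Rightarrow> real" and \<psi> :: "'a \<Rightarrow> ereal"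
    and p :: nat and c :: real and \<gamma> :: "nat \<Rightarrow> real" and x :: "nat \<Rightarrow> 'a"
  assumes "p \<ge> 1"
    and "proper_closed_convex \<psi>"
    and "bounded (eff_dom \<psi>)"
    and "convex_on (eff_dom \<psi>) f"
    and "\<forall>z\<in>eff_dom \<psi>. cont_differentiable_at p f z"
    and "c \<ge> 0"
    and "\<forall>k. \<gamma> k = (real p + 1) / (real k + real p + 1)"
    and "contracting_point_tensor_seq p c f \<psi> \<gamma> x"
  shows "\<forall>k\<ge>1. objective f \<psi> (x k) - opt_value f \<psi>
           \<le> ereal ((real p + 1) ^ (p + 1)) * (ereal c + 2 * taylor_defect p (eff_dom \<psi>) f)
              * ereal (real k powi (- int p))"
proof (intro allI impI)
  fix k :: nat assume k: "1 \<le> k"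
  note \<psi> = assms(2)
  let ?\<Delta> = "taylor_defect p (eff_dom \<psi>) f"
  have "0 \<le> ?\<Delta>"
    using \<psi> by (intro taylor_defect_nonneg) (simp add: proper_closed_convex_def)
  then consider "?\<Delta> = \<infinity>" | D where "?\<Delta> = ereal D" "0 \<le> D"
    by (cases ?\<Delta>) auto
  then show "objective f \<psi> (x k) - opt_value f \<psi>
      \<le> ereal ((real p + 1) ^ (p + 1)) * (ereal c + 2 * ?\<Delta>) * ereal (real k powi (- int p))"
  proof cases
    case 1
    \<comment> \<open>Both outer factors are positive, the last one because
      \<open>k \<ge> 1\<close>, so the right-hand side is \<open>\<infinity>\<close>.\<close>
    then show ?thesis using k by (simp add: add_pos_nonneg)
  next
    case (2 D)
    define F where "F z = f z + real_of_ereal (\<psi> z)" for z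
    have obj: "objective f \<psi> z = ereal (F z)" if "z \<in> eff_dom \<psi>" for z
      using proper_eff_dom_real[OF \<psi> that] by (simp add: objective_def F_def flip: plus_ereal.simps(1))
    obtain \<xi> w where \<gamma>: "\<And>n. 0 < \<gamma> n" "\<And>n. \<gamma> n \<le> 1"
      and \<xi>: "\<And>n. \<xi> n \<le> c * \<gamma> n ^ (p + 1)" and w: "\<And>n. w n \<in> eff_dom \<psi>"
      and min: "\<And>n. model p f \<psi> (\<gamma> n) (x n) ((1 - \<gamma> n) *\<^sub>R x n + \<gamma> n *\<^sub>R w n)
                  - model_min p f \<psi> (\<gamma> n) (x n) \<le> ereal (\<xi> n)"
      and next_x: "\<And>n. x (Suc n) =
          (if objective f \<psi> ((1 - \<gamma> n) *\<^sub>R x n + \<gamma> n *\<^sub>R w n) \<le> objective f \<psi> (x n)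
           then (1 - \<gamma> n) *\<^sub>R x n + \<gamma> n *\<^sub>R w n else x n)"
      using assms(8) unfolding contracting_point_tensor_seq_def by metis
    have x: "x n \<in> eff_dom \<psi>" for n
    proof (induction n)
      case 0
      then show ?case using assms(8) by (simp add: contracting_point_tensor_seq_def)
    next
      case (Suc n)
      then show ?case
        using proper_convex_combination(1)[OF \<psi> Suc w[of n], of "\<gamma> n"] \<gamma>[of n] by (simp add: next_x)
    qed
    define B where "B = (real p + 1) ^ (p + 1) * (c + 2 * D) / real k ^ p"
    have "F (x k) - F v \<le> B" if v: "v \<in> eff_dom \<psi>" for v
      unfolding B_def
    proof (rule contracting_recursion_rate[OF _ _ _ k, where g = \<gamma>])
      show "0 \<le> c + 2 * D" using 2 assms(6) by simp
      fix n
      show "\<gamma> n = (real p + 1) / (real n + real p + 1)" using assms(7) by simp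
      let ?y = "(1 - \<gamma> n) *\<^sub>R x n + \<gamma> n *\<^sub>R w n"
      have "?y \<in> eff_dom \<psi>"
        using proper_convex_combination(1)[OF \<psi> x w] \<gamma>[of n] by simp
      \<comment> \<open>A rejected candidate has a larger objective value than \<open>x n\<close>,
        so the bound at \<open>?y\<close> transfers in both branches.\<close>
      then have "F (x (Suc n)) \<le> F ?y"
        using obj x by (simp add: next_x)
      also have "F ?y - F v \<le> (1 - \<gamma> n) * (F (x n) - F v) + \<xi> n + 2 * D * \<gamma> n ^ (p + 1)"
        unfolding F_def
        using assms(5) x by (intro contracting_point_step[OF \<psi> assms(4) _ 2(1) \<gamma> x w v min]) auto
      finally show "F (x (Suc n)) - F v
          \<le> (1 - \<gamma> n) * (F (x n) - F v) + (c + 2 * D) * \<gamma> n ^ (p + 1)"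
        using \<xi>[of n] by (simp add: algebra_simps)
    qed
    \<comment> \<open>\<open>B\<close> does not depend on \<open>v\<close>, so
      \<open>F (x k) - B\<close> bounds all objective values on the domain from below, hence also
      their infimum.\<close>
    then have "ereal (F (x k) - B) \<le> opt_value f \<psi>"
      unfolding opt_value_def by (intro INF_greatest) (simp add: obj algebra_simps)
    \<comment> \<open>The lower bound just obtained excludes an optimal value of
      \<open>-\<infinity>\<close>.\<close>
    then have "objective f \<psi> (x k) - opt_value f \<psi> \<le> ereal B"
      using obj[OF x] by (cases "opt_value f \<psi>") auto
    also have "ereal B = ereal ((real p + 1) ^ (p + 1)) * (ereal c + 2 * ?\<Delta>) * ereal (real k powi (- int p))"
      using 2 by (simp add: B_def power_int_minus field_simps)
    finally show ?thesis .
  qed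
qed

end
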